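(* Let $G$ be a strongly chordal digraph (with possible loops) in which every vertex has at least one in-neighbour. Then the minimum number of vertices in a dominating set of $G$ equals the maximum number of vertices of $G$ with pairwise disjoint in-neighbourhoods.
   Context: Digraphs are finite, loops are allowed, and there are no parallel arcs. A vertex with a loop is an in-neighbour and out-neighbour of itself; the in-neighbourhood of $v$ is $\{u:(u,v)\in A(G)\}$. A strong ordering of a digraph is a linear ordering $v_1,\dots,v_n$ of its vertices such that for all $i<j$ and $k<\ell$ (not necessarily distinct), if $(v_i,v_k),(v_i,v_\ell),(v_j,v_k)$ are arcs then $(v_j,v_\ell)$ is an arc. A digraph is strongly chordal if it has a strong ordering. A dominating set is a set $D\subseteq V(G)$ such that every vertex of $G$ has an in-neighbour in $D$ (so a vertex with a loop can dominate itself, while a loopless vertex cannot). *)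

theory Defs
  imports "Graph_Theory.Pair_Digraph" "HOL-Library.Disjoint_Sets"
begin

(* A finite digraph with possible loops and no parallel arcs is a pair_pre_digraph satisfying
   pair_fin_digraph: its arcs form a finite set of ordered pairs (tail, head) of vertices. *)

definition in_neighbourhood :: "'a pair_pre_digraph \<Rightarrow> 'a \<Rightarrow> 'a set" where
  "in_neighbourhood G v = {u. (u, v) \<in> parcs G}"

definition strong_ordering :: "'a pair_pre_digraph \<Rightarrow> 'a list \<Rightarrow> bool" where
  "strong_ordering G vs \<longleftrightarrow>
     distinct vs \<and> set vs = pverts G \<and>
     (\<forall>i j k l. i < j \<and> j < length vs \<and> k < l \<and> l < length vs \<longrightarrow>
        (vs ! i, vs ! k) \<in> parcs G \<and> (vs ! i, vs ! l) \<in> parcs G \<and> (vs ! j, vs ! k) \<in> parcs G \<longrightarrow>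
        (vs ! j, vs ! l) \<in> parcs G)"

definition strongly_chordal :: "'a pair_pre_digraph \<Rightarrow> bool" where
  "strongly_chordal G \<longleftrightarrow> (\<exists>vs. strong_ordering G vs)"

definition dominating_set :: "'a pair_pre_digraph \<Rightarrow> 'a set \<Rightarrow> bool" where
  "dominating_set G D \<longleftrightarrow>
     D \<subseteq> pverts G \<and> (\<forall>v \<in> pverts G. in_neighbourhood G v \<inter> D \<noteq> {})"

end

(* In a strong ordering, process the vertices as heads from first to last.  Whenever the current
   vertex v is not yet dominated, put v into S and its last in-neighbour r(v) into D.  If v < w both
   lie in S and share an in-neighbour u, then u <= r(v), so the ordering condition on the arcs
   (u, v), (u, w), (r(v), v) gives the arc (r(v), w); but then w was already dominated when it was
   processed.  So D is dominating, S has disjoint in-neighbourhoods, and |D| <= |S|.  Conversely a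
   dominating set contains distinct in-neighbours of any vertices with disjoint in-neighbourhoods. *)

theory Submission
  imports Defs
begin

lemma greedy_transversal:
  fixes N :: "nat \<Rightarrow> 'b set"
  assumes "\<And>k. k < n \<Longrightarrow> r k \<in> N k"
  shows "\<exists>S\<subseteq>{..<n}. (\<forall>l<n. r ` S \<inter> N l \<noteq> {}) \<and> (\<forall>k\<in>S. \<forall>l\<in>S. k < l \<longrightarrow> r k \<notin> N l)"
  using assms
proof (induction n)
  case 0
  then show ?case by auto
next
  case (Suc n)
  then obtain S where S: "S \<subseteq> {..<n}" "\<forall>l<n. r ` S \<inter> N l \<noteq> {}"
    "\<forall>k\<in>S. \<forall>l\<in>S. k < l \<longrightarrow> r k \<notin> N l"
    by (metis less_Suc_eq)
  show ?case
  proof (cases "r ` S \<inter> N n = {}")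
    case True
    have "insert n S \<subseteq> {..<Suc n}"
      using S(1) by auto
    moreover have "\<forall>l<Suc n. r ` insert n S \<inter> N l \<noteq> {}"
      using S(2) Suc.prems[of n] by (auto simp: less_Suc_eq)
    moreover have "\<forall>k\<in>insert n S. \<forall>l\<in>insert n S. k < l \<longrightarrow> r k \<notin> N l"
      using S(1,3) True by auto
    ultimately show ?thesis by blast
  next
    case False
    then have "\<forall>l<Suc n. r ` S \<inter> N l \<noteq> {}"
      using S(2) by (simp add: less_Suc_eq)
    moreover have "S \<subseteq> {..<Suc n}"
      using S(1) by auto
    ultimately show ?thesis
      using S(3) by blast
  qed
qed

text \<open>Weak duality: choosing for each vertex of \<open>S\<close> an in-neighbour in
  \<open>D\<close> is injective, since a repeated choice would lie in two disjoint
  in-neighbourhoods.\<close>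

lemma card_disjoint_le_card_dominating:
  assumes "finite D" "dominating_set G D"
    and "S \<subseteq> pverts G" "disjoint_family_on (in_neighbourhood G) S"
  shows "card S \<le> card D"
proof -
  have "\<forall>v\<in>S. \<exists>u. u \<in> in_neighbourhood G v \<inter> D"
    using assms by (auto simp: dominating_set_def)
  then obtain f where f: "\<And>v. v \<in> S \<Longrightarrow> f v \<in> in_neighbourhood G v \<inter> D"
    by metis
  have "inj_on f S"
    using f assms(4) by (fastforce simp: disjoint_family_on_def inj_on_def)
  moreover have "f ` S \<subseteq> D"
    using f by auto
  ultimately show ?thesis
    using \<open>finite D\<close> by (rule card_inj_on_le)
qed

text \<open>Supplies a primal-dual pair. The inequality suffices, since weak duality gives its
  converse; so \<open>r\<close> need not be shown injective on \<open>S\<close>.\<close>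

lemma strong_ordering_dominating_disjoint:
  assumes "pair_wf_digraph G" and ord: "strong_ordering G vs"
    and nonempty: "\<forall>v \<in> pverts G. in_neighbourhood G v \<noteq> {}"
  obtains D S where "dominating_set G D" "S \<subseteq> pverts G"
    "disjoint_family_on (in_neighbourhood G) S" "card D \<le> card S"
proof -
  interpret pair_wf_digraph G by fact
  define n where "n = length vs"
  \<comment> \<open>In-neighbourhoods become sets of positions, so that the last in-neighbour is a
    \<open>Max\<close>. The bound \<open>i < n\<close> keeps them finite and within the range where
    \<open>(!) vs\<close> is injective.\<close>
  define N where "N = (\<lambda>k. {i. i < n \<and> (vs ! i, vs ! k) \<in> parcs G})"
  define r where "r = (\<lambda>k. Max (N k))"
  have dist: "distinct vs" and verts: "set vs = pverts G"
    using ord by (auto simp: strong_ordering_def)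
  have gamma: "j \<in> N l" if "i < j" "k < l" "l < n" "i \<in> N k" "i \<in> N l" "j \<in> N k" for i j k l
    using ord that unfolding strong_ordering_def N_def n_def by blast
  have nbh: "in_neighbourhood G (vs ! k) = (!) vs ` N k" for k
  proof -
    have "u \<in> set vs" if "(u, vs ! k) \<in> parcs G" for u
      using that verts in_arcsD1 by auto
    then show ?thesis
      by (fastforce simp: in_neighbourhood_def N_def n_def in_set_conv_nth)
  qed
  have fin: "finite (N k)" for k
    by (simp add: N_def)
  have rmem: "r k \<in> N k" if "k < n" for k
  proof -
    have "vs ! k \<in> pverts G"
      using nth_mem[of k vs] that verts by (simp add: n_def)
    then have "in_neighbourhood G (vs ! k) \<noteq> {}"
      using nonempty by blast
    then have "N k \<noteq> {}"
      by (simp add: nbh)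
    then show ?thesis
      using Max_in[OF fin] by (simp add: r_def)
  qed
  have "\<exists>S\<subseteq>{..<n}. (\<forall>l<n. r ` S \<inter> N l \<noteq> {}) \<and> (\<forall>k\<in>S. \<forall>l\<in>S. k < l \<longrightarrow> r k \<notin> N l)"
    using rmem by (rule greedy_transversal)
  then obtain S where S: "S \<subseteq> {..<n}" "\<forall>l<n. r ` S \<inter> N l \<noteq> {}"
    "\<forall>k\<in>S. \<forall>l\<in>S. k < l \<longrightarrow> r k \<notin> N l"
    by (elim exE conjE)
  have disj: "N k \<inter> N l = {}" if "k \<in> S" "l \<in> S" "k < l" for k l
  proof (rule ccontr)
    assume "N k \<inter> N l \<noteq> {}"
    then obtain i where i: "i \<in> N k" "i \<in> N l" by auto
    have "k < n" "l < n"
      using that S(1) by auto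
    have "i \<le> r k"
      using i fin by (simp add: r_def)
    \<comment> \<open>The ordering condition needs \<open>i < r k\<close>; if
      \<open>i = r k\<close>, the claim is the choice of \<open>i\<close> itself.\<close>
    then have "r k \<in> N l"
      using gamma[of i "r k" k l] i rmem[OF \<open>k < n\<close>] \<open>k < l\<close> \<open>l < n\<close>
      by (cases "i = r k") auto
    then show False
      using S(3) that by blast
  qed
  have inj: "inj_on ((!) vs) {..<n}"
    using dist by (simp add: n_def inj_on_nth)
  \<comment> \<open>Injectivity on positions carries disjointness over to the vertices.\<close>
  have img: "(!) vs ` N k \<inter> (!) vs ` N l = (!) vs ` (N k \<inter> N l)" for k l
    by (rule inj_on_image_Int[OF inj, symmetric]) (auto simp: N_def)
  have sub: "(!) vs ` {..<n} = pverts G"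
    using verts by (auto simp: n_def set_conv_nth)
  show thesis
  proof
    show "(!) vs ` S \<subseteq> pverts G"
      using S(1) sub by blast
    show "disjoint_family_on (in_neighbourhood G) ((!) vs ` S)"
      unfolding disjoint_family_on_def
    proof (intro ballI impI)
      fix v w
      assume "v \<in> (!) vs ` S" "w \<in> (!) vs ` S" "v \<noteq> w"
      then obtain k l where kl: "k \<in> S" "l \<in> S" "k \<noteq> l" "v = vs ! k" "w = vs ! l"
        by auto
      have "N k \<inter> N l = {}"
        using disj[of k l] disj[of l k] kl(1-3) by (cases "k < l") auto
      then show "in_neighbourhood G v \<inter> in_neighbourhood G w = {}"
        by (simp add: kl(4,5) nbh img)
    qed
    have "r ` S \<subseteq> {..<n}"
      using rmem S(1) by (auto simp: N_def)
    moreover have "in_neighbourhood G v \<inter> (!) vs ` r ` S \<noteq> {}" if v: "v \<in> pverts G" for v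
    proof -
      obtain l where "l < n" "v = vs ! l"
        using v sub by auto
      then show ?thesis
        using S(2)[rule_format, of l] nbh[of l] by blast
    qed
    ultimately show "dominating_set G ((!) vs ` r ` S)"
      unfolding dominating_set_def using sub by blast
    have "finite S"
      using S(1) finite_subset by blast
    then have "card ((!) vs ` r ` S) \<le> card S"
      by (simp add: image_image card_image_le)
    also have "card S = card ((!) vs ` S)"
      using card_image[OF inj_on_subset[OF inj S(1)]] by simp
    finally show "card ((!) vs ` r ` S) \<le> card ((!) vs ` S)" .
  qed
qed

theorem theorem34:
  fixes G :: "'a pair_pre_digraph"
  assumes "pair_fin_digraph G"
    and "strongly_chordal G"
    and "\<forall>v \<in> pverts G. in_neighbourhood G v \<noteq> {}"
  shows "Min (card ` {D. dominating_set G D}) =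
         Max (card ` {S. S \<subseteq> pverts G \<and> disjoint_family_on (in_neighbourhood G) S})"
proof -
  interpret pair_fin_digraph G by fact
  let ?A = "{D. dominating_set G D}"
  let ?B = "{S. S \<subseteq> pverts G \<and> disjoint_family_on (in_neighbourhood G) S}"
  have "?A \<subseteq> Pow (pverts G)" "?B \<subseteq> Pow (pverts G)"
    by (auto simp: dominating_set_def)
  then have fin: "finite ?A" "finite ?B"
    by (simp_all add: finite_subset)
  obtain vs where "strong_ordering G vs"
    using assms(2) by (auto simp: strongly_chordal_def)
  then obtain D S where D: "D \<in> ?A" and S: "S \<in> ?B" and le: "card D \<le> card S"
    using strong_ordering_dominating_disjoint[OF pair_wf_digraph_axioms _ assms(3)] by blast
  have weak: "card S' \<le> card D'" if "D' \<in> ?A" "S' \<in> ?B" for D' S'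
  proof -
    have "finite D'"
      using that finite_subset[OF _ finite_verts] by (simp add: dominating_set_def)
    then show ?thesis
      using card_disjoint_le_card_dominating that by blast
  qed
  \<comment> \<open>\<open>S\<close> certifies that \<open>D\<close> is minimum: every dominating
    set has at least \<open>card S\<close> elements, and \<open>card D \<le> card S\<close>.\<close>
  have "Min (card ` ?A) = card D"
    using D weak[OF _ S] le fin by (intro Min_eqI) (auto intro: order_trans)
  moreover have "Max (card ` ?B) = card D"
  proof (rule Max_eqI)
    \<comment> \<open>The value is attained by \<open>S\<close>, because the two inequalities force
      \<open>card S = card D\<close>.\<close>
    show "card D \<in> card ` ?B"
      using S le weak[OF D S] by (metis imageI order_antisym)
  qed (use fin weak[OF D] in auto)
  ultimately show ?thesis by simp
qed

end
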